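(* Let $1<\alpha\le\sqrt2$. Then the set of minimal vectors of $E_8^\alpha$ is $S(E_8^\alpha)=\{\pm\mathbf{b}_1,\dots,\pm\mathbf{b}_8\}$. In particular $\lambda_1^2(E_8^\alpha)=2$ and $E_8^\alpha$ is generic well-rounded.
   Context: Let $\mathbf{e}_1,\dots,\mathbf{e}_8$ be the standard basis of $\mathbb{R}^8$. For $1\le\alpha\le\sqrt2$ and $\overline\alpha:=\sqrt{2-\alpha^2}$, $E_8^\alpha$ is the lattice with basis $\mathbf{b}_1=\frac12(1,1,1,1,1,1,-1,1)^T$ and $\mathbf{b}_k=\alpha\mathbf{e}_{k-1}+\overline\alpha\mathbf{e}_k$ for $2\le k\le8$. $S(\Lambda)$ is the set of vectors of $\Lambda$ of norm $\lambda_1(\Lambda)=\min_{0\ne\mathbf{x}\in\Lambda}\|\mathbf{x}\|$. A lattice in $\mathbb{R}^n$ is generic well-rounded if $S(\Lambda)$ spans $\mathbb{R}^n$ and $|S(\Lambda)|=2n$. *)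

theory Defs
  imports "HOL-Analysis.Analysis"
begin

text \<open>Vectors of R^8 are modelled as real^8. The standard basis vector e_k
  (1 \<le> k \<le> 8) is the k-th unit vector, i.e. the axis with (0-based) index k-1.\<close>

definition std_e :: "nat \<Rightarrow> real^8" where
  "std_e k = axis (of_nat (k - 1) :: 8) 1"

definition alpha_bar :: "real \<Rightarrow> real" where
  "alpha_bar \<alpha> = sqrt (2 - \<alpha>\<^sup>2)"

definition E8b :: "real \<Rightarrow> nat \<Rightarrow> real^8" where
  "E8b \<alpha> k = (if k = 1
      then (\<Sum>j\<in>{1..8}. (if j = 7 then - (1/2) else 1/2) *\<^sub>R std_e j)
      else \<alpha> *\<^sub>R std_e (k - 1) + alpha_bar \<alpha> *\<^sub>R std_e k)"

definition E8_alpha :: "real \<Rightarrow> (real^8) set" where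
  "E8_alpha \<alpha> = {\<Sum>k\<in>{1..8}. of_int (c k) *\<^sub>R E8b \<alpha> k | c :: nat \<Rightarrow> int. True}"

definition lambda1 :: "('a::real_normed_vector) set \<Rightarrow> real" where
  "lambda1 L = Inf {norm x | x. x \<in> L \<and> x \<noteq> 0}"

definition min_vectors :: "('a::real_normed_vector) set \<Rightarrow> 'a set" where
  "min_vectors L = {x \<in> L. norm x = lambda1 L}"

definition generic_well_rounded :: "('a::euclidean_space) set \<Rightarrow> bool" where
  "generic_well_rounded L \<longleftrightarrow>
     span (min_vectors L) = UNIV \<and> card (min_vectors L) = 2 * DIM('a)"

end

theory Submission
  imports Defs
begin

text \<open>
  Put C = (\<alpha> + alpha_bar \<alpha>)/2 and s = (\<alpha> - alpha_bar \<alpha>)/2, so that C^2 + s^2 = 1. The squared norm of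
  a lattice vector is a quadratic form in its coefficients whose entries are affine in the triple
  (C^2 - s^2, C, s), and this triple is a convex combination of (1, 1, 0), which gives the E8 root
  lattice, of (1, 1, 1/2), and of some (0, \<gamma>, \<delta>). Forms with values at least 2 on nonzero integer
  vectors are closed under convex combinations. The first two forms are positive definite and
  integral, which nearly suffices for this bound; the third is diagonal once the first coefficient
  is fixed, attains 2 only at the unit vectors, and carries the positive weight 2 s^2.
\<close>

section \<open>The squared norm as a quadratic form in the coefficients\<close>

text \<open>A Gram form in which all eight generators have squared length 2: \<open>\<tau>\<close>
  is the inner product of neighbours from the second generator on, \<open>\<gamma>\<close> that of
  the first with the next five, and \<open>\<delta>\<close>, \<open>- \<delta>\<close> those of the
  first with the last two.\<close>

definition form8 :: "real \<Rightarrow> real \<Rightarrow> real \<Rightarrow> (nat \<Rightarrow> real) \<Rightarrow> real" where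
  "form8 \<tau> \<gamma> \<delta> c = 2 * (\<Sum>k\<in>{1..8}. (c k)\<^sup>2) + 2 * \<tau> * (\<Sum>k\<in>{2..7}. c k * c (k + 1))
     + 2 * c 1 * (\<gamma> * (\<Sum>k\<in>{2..6}. c k) + \<delta> * (c 7 - c 8))"

lemma Icc_2: "{2..7::nat} = {2,3,4,5,6,7}" "{2..6::nat} = {2,3,4,5,6}"
  and Icc_1: "{1..8::nat} = {1,2,3,4,5,6,7,8}"
  by auto

lemma form8_expand:
  "form8 \<tau> \<gamma> \<delta> c =
     2 * ((c 1)\<^sup>2 + (c 2)\<^sup>2 + (c 3)\<^sup>2 + (c 4)\<^sup>2 + (c 5)\<^sup>2 + (c 6)\<^sup>2 + (c 7)\<^sup>2 + (c 8)\<^sup>2)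
     + 2 * \<tau> * (c 2 * c 3 + c 3 * c 4 + c 4 * c 5 + c 5 * c 6 + c 6 * c 7 + c 7 * c 8)
     + 2 * c 1 * (\<gamma> * (c 2 + c 3 + c 4 + c 5 + c 6) + \<delta> * (c 7 - c 8))"
  unfolding form8_def Icc_1 Icc_2 by (simp add: add.assoc)

lemma form8_combination:
  "form8 (p + q) (p + q + r * \<gamma>) (q / 2 + r * \<delta>) c
     = p * form8 1 1 0 c + q * form8 1 1 (1/2) c + r * form8 0 \<gamma> \<delta> c"
  if "p + q + r = 1"
proof -
  have r: "r = 1 - p - q" using that by simp
  have "2 * A + 2 * (p + q) * P + 2 * x * ((p + q + r * \<gamma>) * S + (q / 2 + r * \<delta>) * D)
      = p * (2 * A + 2 * 1 * P + 2 * x * (1 * S + 0 * D)) + q * (2 * A + 2 * 1 * P + 2 * x * (1 * S + 1 / 2 * D))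
        + r * (2 * A + 2 * 0 * P + 2 * x * (\<gamma> * S + \<delta> * D))" for A P S D x :: real
    unfolding r by (simp add: algebra_simps)
  then show ?thesis unfolding form8_def .
qed

lemma std_e_inner:
  assumes "i \<in> {1..8}" "j \<in> {1..8}"
  shows "std_e i \<bullet> std_e j = (if i = j then 1 else 0)"
  using assms unfolding Icc_1 by (auto simp: std_e_def inner_axis_axis)

text \<open>For k >= 2 the vector \<open>E8b \<alpha> k\<close> meets only the axes k - 1 and k, so
  axis 1 receives no \<open>alpha_bar \<alpha>\<close> term and axis 8 no \<alpha> term.\<close>

lemma lattice_vector_coordinates:
  "(\<Sum>k\<in>{1..8}. c k *\<^sub>R E8b \<alpha> k) =
     (\<Sum>j\<in>{1..8}. ((if j = 7 then - c 1 / 2 else c 1 / 2) + (if j = 1 then 0 else alpha_bar \<alpha> * c j)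
        + (if j = 8 then 0 else \<alpha> * c (j + 1))) *\<^sub>R std_e j)"
  unfolding E8b_def Icc_1 by (simp add: algebra_simps flip: numeral_2_eq_2 numeral_3_eq_3)

lemma norm_sum_std_e:
  "(norm (\<Sum>j\<in>{1..8}. y j *\<^sub>R std_e j))\<^sup>2 = (\<Sum>j\<in>{1..8}. (y j)\<^sup>2)"
  unfolding power2_norm_eq_inner
  by (simp add: inner_sum_left inner_sum_right std_e_inner power2_eq_square if_distrib[of "\<lambda>x. _ * x"] cong: if_cong)

text \<open>With \<alpha> = C + s and \<open>alpha_bar \<alpha>\<close> = C - s, neighbours have
  inner product (C + s)(C - s). The first generator gives (\<alpha> +
  \<open>alpha_bar \<alpha>\<close>)/2 = C with the next five; the entry -1/2 on axis 7 turns this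
  into s and -s for the last two.\<close>

lemma norm_lattice_vector:
  assumes "\<alpha>\<^sup>2 \<le> 2"
  defines "C \<equiv> (\<alpha> + alpha_bar \<alpha>) / 2" and "s \<equiv> (\<alpha> - alpha_bar \<alpha>) / 2"
  shows "(norm (\<Sum>k\<in>{1..8}. c k *\<^sub>R E8b \<alpha> k))\<^sup>2 = form8 (C\<^sup>2 - s\<^sup>2) C s c"
proof -
  have "(alpha_bar \<alpha>)\<^sup>2 = 2 - \<alpha>\<^sup>2" using assms(1) by (simp add: alpha_bar_def)
  then have "C\<^sup>2 + s\<^sup>2 = 1" unfolding C_def s_def by (simp add: power2_eq_square field_simps)
  then have s2: "s\<^sup>2 = 1 - C\<^sup>2" by simp
  have \<alpha>: "\<alpha> = C + s" "alpha_bar \<alpha> = C - s" by (simp_all add: C_def s_def field_simps)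
  have norm: "(norm (\<Sum>k\<in>{1..8}. c k *\<^sub>R E8b \<alpha> k))\<^sup>2 =
      (c 1 / 2 + \<alpha> * c 2)\<^sup>2 + (c 1 / 2 + alpha_bar \<alpha> * c 2 + \<alpha> * c 3)\<^sup>2
      + (c 1 / 2 + alpha_bar \<alpha> * c 3 + \<alpha> * c 4)\<^sup>2 + (c 1 / 2 + alpha_bar \<alpha> * c 4 + \<alpha> * c 5)\<^sup>2
      + (c 1 / 2 + alpha_bar \<alpha> * c 5 + \<alpha> * c 6)\<^sup>2 + (c 1 / 2 + alpha_bar \<alpha> * c 6 + \<alpha> * c 7)\<^sup>2
      + (alpha_bar \<alpha> * c 7 + \<alpha> * c 8 - c 1 / 2)\<^sup>2 + (c 1 / 2 + alpha_bar \<alpha> * c 8)\<^sup>2"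
    unfolding lattice_vector_coordinates norm_sum_std_e unfolding Icc_1
    by (simp add: algebra_simps flip: numeral_2_eq_2 numeral_3_eq_3)
  \<comment> \<open>Naming the half keeps division out of the polynomial identity below.\<close>
  define d where "d = c 1 / 2"
  have c1: "c 1 = 2 * d" by (simp add: d_def)
  have "(d + (C + s) * x2)\<^sup>2 + (d + (C - s) * x2 + (C + s) * x3)\<^sup>2 + (d + (C - s) * x3 + (C + s) * x4)\<^sup>2
      + (d + (C - s) * x4 + (C + s) * x5)\<^sup>2 + (d + (C - s) * x5 + (C + s) * x6)\<^sup>2
      + (d + (C - s) * x6 + (C + s) * x7)\<^sup>2 + ((C - s) * x7 + (C + s) * x8 - d)\<^sup>2 + (d + (C - s) * x8)\<^sup>2
    = 2 * (4 * d\<^sup>2 + (C\<^sup>2 + s\<^sup>2) * (x2\<^sup>2 + x3\<^sup>2 + x4\<^sup>2 + x5\<^sup>2 + x6\<^sup>2 + x7\<^sup>2 + x8\<^sup>2))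
     + 2 * (C\<^sup>2 - s\<^sup>2) * (x2 * x3 + x3 * x4 + x4 * x5 + x5 * x6 + x6 * x7 + x7 * x8)
     + 4 * d * (C * (x2 + x3 + x4 + x5 + x6) + s * (x7 - x8))" for x2 x3 x4 x5 x6 x7 x8
    by (simp add: power2_eq_square algebra_simps)
  from this[of "c 2" "c 3" "c 4" "c 5" "c 6" "c 7" "c 8"]
  show ?thesis
    unfolding norm form8_expand \<alpha>(2) unfolding \<alpha>(1) c1 \<open>C\<^sup>2 + s\<^sup>2 = 1\<close>
    by (simp add: power_mult_distrib)
qed

section \<open>Sums of squares and positive definiteness of the three forms\<close>

text \<open>At \<alpha> = 1 also \<open>alpha_bar \<alpha>\<close> = 1, and the eight squares are
  those of the coordinates of the lattice vector.\<close>

lemma form8_root_lattice: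
  "form8 1 1 0 c = (c 1 / 2 + c 2)\<^sup>2 + (c 1 / 2 + c 2 + c 3)\<^sup>2 + (c 1 / 2 + c 3 + c 4)\<^sup>2
     + (c 1 / 2 + c 4 + c 5)\<^sup>2 + (c 1 / 2 + c 5 + c 6)\<^sup>2 + (c 1 / 2 + c 6 + c 7)\<^sup>2
     + (c 7 + c 8 - c 1 / 2)\<^sup>2 + (c 1 / 2 + c 8)\<^sup>2"
proof -
  define d where "d = c 1 / 2"
  have c1: "c 1 = 2 * d" by (simp add: d_def)
  show ?thesis unfolding form8_expand c1 by (simp add: power2_eq_square algebra_simps)
qed

text \<open>This is the root lattice form plus c 1 * (c 7 - c 8). It takes nine squares; the last
  one, a multiple of (c 1)^2 alone, controls large \<open>c 1\<close>.\<close>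

lemma form8_tilted:
  "form8 1 1 (1/2) c = (c 1 / 2 + c 2)\<^sup>2 + (c 1 / 2 + c 2 + c 3)\<^sup>2 + (c 1 / 2 + c 3 + c 4)\<^sup>2
     + (c 1 / 2 + c 4 + c 5)\<^sup>2 + (c 1 / 2 + c 5 + c 6)\<^sup>2 + (c 1 / 2 + c 6 + c 7)\<^sup>2
     + (c 7 + c 8)\<^sup>2 + (c 8 - c 1 / 2)\<^sup>2 + (c 1)\<^sup>2 / 4"
proof -
  define d where "d = c 1 / 2"
  have c1: "c 1 = 2 * d" by (simp add: d_def)
  show ?thesis unfolding form8_expand c1 by (simp add: power2_eq_square algebra_simps)
qed

text \<open>No products among c 2, ..., c 8 occur, so the square is completed in each of them
  separately, leaving a multiple of (c 1)^2.\<close>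

lemma form8_diagonal:
  "form8 0 \<gamma> \<delta> c = 2 * ((c 2 + \<gamma> * c 1 / 2)\<^sup>2 + (c 3 + \<gamma> * c 1 / 2)\<^sup>2 + (c 4 + \<gamma> * c 1 / 2)\<^sup>2
     + (c 5 + \<gamma> * c 1 / 2)\<^sup>2 + (c 6 + \<gamma> * c 1 / 2)\<^sup>2 + (c 7 + \<delta> * c 1 / 2)\<^sup>2 + (c 8 - \<delta> * c 1 / 2)\<^sup>2)
     + (2 - (5 * \<gamma>\<^sup>2 + 2 * \<delta>\<^sup>2) / 2) * (c 1)\<^sup>2"
proof -
  define d where "d = c 1 / 2"
  have c1: "c 1 = 2 * d" by (simp add: d_def)
  show ?thesis unfolding form8_expand c1 by (simp add: power2_eq_square algebra_simps)
qed

lemma ball_1_8: "(\<forall>k\<in>{1..8::nat}. P k) \<longleftrightarrow> P 1 \<and> P 2 \<and> P 3 \<and> P 4 \<and> P 5 \<and> P 6 \<and> P 7 \<and> P 8"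
  unfolding Icc_1 by simp

lemma sum8_zero:
  fixes x1 :: real
  assumes "x1\<^sup>2 + x2\<^sup>2 + x3\<^sup>2 + x4\<^sup>2 + x5\<^sup>2 + x6\<^sup>2 + x7\<^sup>2 + x8\<^sup>2 \<le> 0"
  shows "x1 = 0 \<and> x2 = 0 \<and> x3 = 0 \<and> x4 = 0 \<and> x5 = 0 \<and> x6 = 0 \<and> x7 = 0 \<and> x8 = 0"
proof -
  have "x1\<^sup>2 + x2\<^sup>2 + x3\<^sup>2 + x4\<^sup>2 + x5\<^sup>2 + x6\<^sup>2 + x7\<^sup>2 + x8\<^sup>2 = 0"
    using assms by (intro antisym) simp_all
  then show ?thesis by (simp add: add_nonneg_eq_0_iff)
qed

lemma form8_root_lattice_pos:
  assumes "\<exists>k\<in>{1..8}. c k \<noteq> 0"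
  shows "0 < form8 1 1 0 c"
proof (rule ccontr)
  assume "\<not> 0 < form8 1 1 0 c"
  from sum8_zero[OF this[unfolded form8_root_lattice not_less]]
  \<comment> \<open>The first seven equations give c 3 = c 5 = c 7 = 0, c 2 = c 4 = c 6 = - c 1 / 2
    and c 8 = c 1 / 2; the eighth then gives c 1 = 0.\<close>
  have "\<forall>k\<in>{1..8}. c k = 0" unfolding ball_1_8 by argo
  with assms show False by blast
qed

lemma form8_tilted_pos:
  assumes "\<exists>k\<in>{1..8}. c k \<noteq> 0"
  shows "0 < form8 1 1 (1/2) c"
proof (rule ccontr)
  assume "\<not> 0 < form8 1 1 (1/2) c"
  \<comment> \<open>One of the nine squares is dropped to leave eight for \<open>sum8_zero\<close>;
    the remaining (c 1)^2 / 4 already forces c 1 = 0.\<close>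
  moreover have "0 \<le> (c 8 - c 1 / 2)\<^sup>2" "(c 1 / 2)\<^sup>2 = (c 1)\<^sup>2 / 4" by (simp_all add: power_divide)
  ultimately have "(c 1 / 2 + c 2)\<^sup>2 + (c 1 / 2 + c 2 + c 3)\<^sup>2 + (c 1 / 2 + c 3 + c 4)\<^sup>2
     + (c 1 / 2 + c 4 + c 5)\<^sup>2 + (c 1 / 2 + c 5 + c 6)\<^sup>2 + (c 1 / 2 + c 6 + c 7)\<^sup>2
     + (c 7 + c 8)\<^sup>2 + (c 1 / 2)\<^sup>2 \<le> 0"
    unfolding form8_tilted by linarith
  from sum8_zero[OF this] have "\<forall>k\<in>{1..8}. c k = 0" unfolding ball_1_8 by argo
  with assms show False by blast
qed

lemma form8_diagonal_pos:
  assumes "\<exists>k\<in>{1..8}. c k \<noteq> 0" "5 * \<gamma>\<^sup>2 + 2 * \<delta>\<^sup>2 < 4"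
  shows "0 < form8 0 \<gamma> \<delta> c"
proof (cases "c 1 = 0")
  case False
  then have "0 < (2 - (5 * \<gamma>\<^sup>2 + 2 * \<delta>\<^sup>2) / 2) * (c 1)\<^sup>2" using assms(2) by simp
  then show ?thesis unfolding form8_diagonal by (intro add_nonneg_pos mult_nonneg_nonneg add_nonneg_nonneg) auto
next
  case True
  show ?thesis
  proof (rule ccontr)
    assume "\<not> 0 < form8 0 \<gamma> \<delta> c"
    with True have "(c 1)\<^sup>2 + (c 2)\<^sup>2 + (c 3)\<^sup>2 + (c 4)\<^sup>2 + (c 5)\<^sup>2 + (c 6)\<^sup>2 + (c 7)\<^sup>2 + (c 8)\<^sup>2 \<le> 0"
      unfolding form8_expand by simp
    from sum8_zero[OF this] have "\<forall>k\<in>{1..8}. c k = 0" unfolding ball_1_8 by argo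
    with assms show False by blast
  qed
qed

section \<open>Lower bounds on nonzero integer vectors\<close>

text \<open>All coefficients of this form are even integers, so a positive value is at least
  2.\<close>

lemma form8_root_lattice_ge:
  fixes c :: "nat \<Rightarrow> int"
  assumes "\<exists>k\<in>{1..8}. c k \<noteq> 0"
  shows "2 \<le> form8 1 1 0 (\<lambda>k. of_int (c k))"
proof -
  define n where "n = (\<Sum>k\<in>{1..8}. (c k)\<^sup>2) + (\<Sum>k\<in>{2..7}. c k * c (k + 1)) + c 1 * (\<Sum>k\<in>{2..6}. c k)"
  have "form8 1 1 0 (\<lambda>k. of_int (c k)) = 2 * of_int n" by (simp add: form8_def n_def)
  with form8_root_lattice_pos[of "\<lambda>k. of_int (c k)"] assms show ?thesis by simp
qed

text \<open>The form is integral but not even, because of c 1 * (c 7 - c 8), so parity settles only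
  even \<open>c 1\<close>. For c 1 = 1 or -1 the squares are bounded one by one, and for larger odd
  \<open>c 1\<close> the ninth square alone is at least 9/4.\<close>

lemma form8_tilted_ge:
  fixes c :: "nat \<Rightarrow> int"
  assumes "\<exists>k\<in>{1..8}. c k \<noteq> 0"
  shows "2 \<le> form8 1 1 (1/2) (\<lambda>k. of_int (c k))"
proof -
  define n where "n = (\<Sum>k\<in>{1..8}. (c k)\<^sup>2) + (\<Sum>k\<in>{2..7}. c k * c (k + 1)) + c 1 * (\<Sum>k\<in>{2..6}. c k)"
  have eq: "form8 1 1 (1/2) (\<lambda>k. of_int (c k)) = of_int (2 * n + c 1 * (c 7 - c 8))"
    by (simp add: form8_def n_def algebra_simps)
  have pos: "0 < form8 1 1 (1/2) (\<lambda>k. of_int (c k))"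
    using form8_tilted_pos[of "\<lambda>k. of_int (c k)"] assms by simp
  consider "even (c 1)" | "\<bar>c 1\<bar> = 1" | "3 \<le> \<bar>c 1\<bar>"
  proof -
    have "even (c 1) \<or> \<bar>c 1\<bar> = 1 \<or> 3 \<le> \<bar>c 1\<bar>" by presburger
    with that show thesis by blast
  qed
  then show ?thesis
  proof cases
    case 1
    then have "even (2 * n + c 1 * (c 7 - c 8))" by simp
    then obtain m where m: "2 * n + c 1 * (c 7 - c 8) = 2 * m" by (elim evenE)
    then have "0 < m" using pos unfolding eq m by simp
    then show ?thesis unfolding eq m by simp
  next
    case 2
    define e where "e = c 1"
    have e: "e\<^sup>2 = 1" using 2 by (metis e_def power2_abs one_power2)
    have ge: "0 \<le> u\<^sup>2 + e * u" for u :: int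
    proof -
      have "\<bar>e * u\<bar> = \<bar>u\<bar>" using 2 by (simp add: e_def abs_mult)
      moreover have "\<bar>u\<bar> \<le> u\<^sup>2"
      proof (cases "u = 0")
        case False
        then have "\<bar>u\<bar> \<le> \<bar>u\<bar>\<^sup>2" by (intro self_le_power) auto
        then show ?thesis by simp
      qed simp
      ultimately show ?thesis by linarith
    qed
    \<comment> \<open>Seven of the squares have the shape (u + e/2)^2 = u^2 + e u + 1/4; their
      quarters and (c 1)^2 / 4 add up to the constant 2.\<close>
    have "2 * n + c 1 * (c 7 - c 8) = 2 + ((c 2)\<^sup>2 + e * c 2) + ((c 2 + c 3)\<^sup>2 + e * (c 2 + c 3))
      + ((c 3 + c 4)\<^sup>2 + e * (c 3 + c 4)) + ((c 4 + c 5)\<^sup>2 + e * (c 4 + c 5))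
      + ((c 5 + c 6)\<^sup>2 + e * (c 5 + c 6)) + ((c 6 + c 7)\<^sup>2 + e * (c 6 + c 7))
      + (c 7 + c 8)\<^sup>2 + ((- c 8)\<^sup>2 + e * (- c 8))"
      using e unfolding n_def Icc_1 Icc_2
      by (simp add: e_def[symmetric, unfolded One_nat_def] power2_eq_square algebra_simps)
    then have "2 \<le> 2 * n + c 1 * (c 7 - c 8)"
      using ge[of "c 2"] ge[of "c 2 + c 3"] ge[of "c 3 + c 4"] ge[of "c 4 + c 5"] ge[of "c 5 + c 6"]
        ge[of "c 6 + c 7"] ge[of "- c 8"] zero_le_power2[of "c 7 + c 8"] by linarith
    then show ?thesis unfolding eq by linarith
  next
    case 3
    then have "9 \<le> (c 1)\<^sup>2" using power_mono[of 3 "\<bar>c 1\<bar>" 2] by simp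
    then have "9/4 \<le> (real_of_int (c 1))\<^sup>2 / 4" by (simp flip: of_int_power)
    moreover have "0 \<le> form8 1 1 (1/2) (\<lambda>k. of_int (c k)) - (real_of_int (c 1))\<^sup>2 / 4"
      unfolding form8_tilted by (simp add: add_nonneg_nonneg)
    ultimately show ?thesis by linarith
  qed
qed

text \<open>The worst sign gives a parabola in |x| with vertex |g|/2 between 1/2 and 3/2, so |x| = 1
  minimises it over the integers.\<close>

lemma int_quadratic_bound:
  fixes x :: int and g :: real
  assumes "1 \<le> \<bar>g\<bar>" "\<bar>g\<bar> \<le> 3"
  shows "1 - \<bar>g\<bar> \<le> (of_int x)\<^sup>2 + g * of_int x"
proof -
  define m where "m = \<bar>real_of_int x\<bar>"
  have "x = 0 \<or> \<bar>x\<bar> = 1 \<or> 2 \<le> \<bar>x\<bar>" by arith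
  then have "m = 0 \<or> m = 1 \<or> 2 \<le> m" by (auto simp: m_def)
  \<comment> \<open>The product is m^2 - |g| m minus its value at m = 1.\<close>
  then have "0 \<le> (m - 1) * (m + 1 - \<bar>g\<bar>)"
    using assms by (elim disjE) (simp_all add: mult_nonneg_nonneg)
  moreover have "- (\<bar>g\<bar> * m) \<le> g * of_int x" unfolding m_def abs_mult[symmetric] by linarith
  moreover have "(real_of_int x)\<^sup>2 = m\<^sup>2" by (simp add: m_def)
  ultimately show ?thesis by (simp add: power2_eq_square algebra_simps)
qed

text \<open>The vertex -g/2 is closer to 0 than 1/2, so 0 is the only integer minimiser.\<close>

lemma int_quadratic_pos:
  fixes x :: int and g :: real
  assumes "\<bar>g\<bar> < 1"
  shows "0 \<le> (of_int x)\<^sup>2 + g * of_int x"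
    and "(of_int x)\<^sup>2 + g * of_int x \<le> 0 \<Longrightarrow> x = 0"
proof -
  have *: "0 < (of_int x)\<^sup>2 + g * of_int x" if "x \<noteq> 0"
  proof -
    have "1 \<le> \<bar>x\<bar>" using that by arith
    then have x: "1 \<le> \<bar>real_of_int x\<bar>" by linarith
    have "\<bar>g * of_int x\<bar> < 1 * \<bar>real_of_int x\<bar>" unfolding abs_mult using assms x by (intro mult_strict_right_mono) auto
    also have "\<dots> \<le> \<bar>real_of_int x\<bar> * \<bar>real_of_int x\<bar>" using x by (intro mult_right_mono) auto
    also have "\<dots> = (of_int x)\<^sup>2" by (simp add: power2_eq_square)
    finally show ?thesis by linarith
  qed
  show "0 \<le> (of_int x)\<^sup>2 + g * of_int x" using * by (cases "x = 0") auto
  show "(of_int x)\<^sup>2 + g * of_int x \<le> 0 \<Longrightarrow> x = 0" using * by fastforce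
qed

text \<open>For fixed \<open>c 1\<close> the other seven coefficients are minimised independently.
  The minimiser is 0 in each when |c 1| = 1, which yields the equality case; for |c 1| = 2, 3 the
  bound comes from \<open>int_quadratic_bound\<close>, and beyond that from the leftover multiple of
  (c 1)^2.\<close>

lemma form8_diagonal_ge:
  fixes c :: "nat \<Rightarrow> int"
  assumes nz: "\<exists>k\<in>{1..8}. c k \<noteq> 0"
    and \<gamma>: "1/2 \<le> \<gamma>" "\<gamma> < 1" and \<delta>: "1/2 \<le> \<delta>" "\<delta> < 1"
    and lin: "10 * \<gamma> + 4 * \<delta> < 10" and quad: "5 * \<gamma>\<^sup>2 + 2 * \<delta>\<^sup>2 < 15/4"
  shows "2 < form8 0 \<gamma> \<delta> (\<lambda>k. of_int (c k)) \<or>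
    form8 0 \<gamma> \<delta> (\<lambda>k. of_int (c k)) = 2 \<and> (\<Sum>k\<in>{1..8}. (c k)\<^sup>2) = 1"
proof -
  define g d where "g = \<gamma> * of_int (c 1)" and "d = \<delta> * of_int (c 1)"
  define q where "q h k = (of_int (c k))\<^sup>2 + h * of_int (c k)" for h :: real and k
  have split: "form8 0 \<gamma> \<delta> (\<lambda>k. of_int (c k)) =
      2 * ((of_int (c 1))\<^sup>2 + q g 2 + q g 3 + q g 4 + q g 5 + q g 6 + q d 7 + q (- d) 8)"
    unfolding form8_expand g_def d_def q_def by (simp add: algebra_simps)
  consider "c 1 = 0" | "\<bar>c 1\<bar> = 1" | "\<bar>c 1\<bar> = 2 \<or> \<bar>c 1\<bar> = 3" | "4 \<le> \<bar>c 1\<bar>" by arith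
  then show ?thesis
  proof cases
    case 1
    have "form8 0 \<gamma> \<delta> (\<lambda>k. of_int (c k)) = 2 * of_int (\<Sum>k\<in>{1..8}. (c k)\<^sup>2)"
      using 1 by (simp add: form8_def)
    moreover have "0 < (\<Sum>k\<in>{1..8}. (c k)\<^sup>2)"
    proof -
      from nz obtain k where "k \<in> {1..8}" "c k \<noteq> 0" by blast
      then show ?thesis by (intro sum_pos2[of _ k]) auto
    qed
    ultimately show ?thesis by linarith
  next
    case 2
    then have a1: "\<bar>real_of_int (c 1)\<bar> = 1" by linarith
    then have ab: "\<bar>g\<bar> < 1" "\<bar>d\<bar> < 1" "\<bar>- d\<bar> < 1" using \<gamma> \<delta> by (simp_all add: g_def d_def abs_mult)
    have c1: "(c 1)\<^sup>2 = 1" "(real_of_int (c 1))\<^sup>2 = 1" using 2 a1 by (metis power2_abs one_power2)+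
    note pos = int_quadratic_pos(1)[OF ab(1)] int_quadratic_pos(1)[OF ab(2)] int_quadratic_pos(1)[OF ab(3)]
    have nn: "0 \<le> q g k" "0 \<le> q d k" "0 \<le> q (- d) k" for k unfolding q_def by (rule pos)+
    show ?thesis
    proof (cases "2 < form8 0 \<gamma> \<delta> (\<lambda>k. of_int (c k))")
      case False
      then have "q g 2 + q g 3 + q g 4 + q g 5 + q g 6 + q d 7 + q (- d) 8 \<le> 0" unfolding split c1 by simp
      then have "q g 2 + q g 3 + q g 4 + q g 5 + q g 6 + q d 7 + q (- d) 8 = 0"
        by (intro antisym add_nonneg_nonneg nn)
      then have "q g 2 = 0" "q g 3 = 0" "q g 4 = 0" "q g 5 = 0" "q g 6 = 0" "q d 7 = 0" "q (- d) 8 = 0"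
        by (simp_all add: add_nonneg_eq_0_iff nn)
      then have z: "c 2 = 0" "c 3 = 0" "c 4 = 0" "c 5 = 0" "c 6 = 0" "c 7 = 0" "c 8 = 0"
        unfolding q_def using int_quadratic_pos(2)[OF ab(1)] int_quadratic_pos(2)[OF ab(2)]
          int_quadratic_pos(2)[OF ab(3)] by (metis order_refl)+
      then have "(\<Sum>k\<in>{1..8}. (c k)\<^sup>2) = 1" unfolding Icc_1 using c1 by simp
      moreover have "form8 0 \<gamma> \<delta> (\<lambda>k. of_int (c k)) = 2" unfolding split c1 q_def z by simp
      ultimately show ?thesis by blast
    qed simp
  next
    case 3
    define m where "m = \<bar>real_of_int (c 1)\<bar>"
    have m: "m = 2 \<or> m = 3" using 3 unfolding m_def by linarith
    have abs: "\<bar>g\<bar> = m * \<gamma>" "\<bar>d\<bar> = m * \<delta>" "\<bar>- d\<bar> = m * \<delta>" using \<gamma> \<delta> by (simp_all add: g_def d_def m_def abs_mult)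
    have bd: "1 \<le> m * \<gamma>" "m * \<gamma> \<le> 3" "1 \<le> m * \<delta>" "m * \<delta> \<le> 3" using m \<gamma> \<delta> by auto
    have ge: "1 - m * \<gamma> \<le> q g k" "1 - m * \<delta> \<le> q d k" "1 - m * \<delta> \<le> q (- d) k" for k
      unfolding q_def using int_quadratic_bound[of g] int_quadratic_bound[of d] int_quadratic_bound[of "-d"] bd
      unfolding abs by blast+
    have "(real_of_int (c 1))\<^sup>2 = m\<^sup>2" by (simp add: m_def)
    \<comment> \<open>For m = 2 this is exactly \<open>lin\<close>, and for m = 3 it is
      \<open>lin\<close> multiplied by 3/2.\<close>
    moreover have "1 < m\<^sup>2 + 7 - 5 * (m * \<gamma>) - 2 * (m * \<delta>)" using m lin by auto
    ultimately have "1 < (real_of_int (c 1))\<^sup>2 + q g 2 + q g 3 + q g 4 + q g 5 + q g 6 + q d 7 + q (- d) 8"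
      using ge(1)[of 2] ge(1)[of 3] ge(1)[of 4] ge(1)[of 5] ge(1)[of 6] ge(2)[of 7] ge(3)[of 8]
      by linarith
    then show ?thesis unfolding split by simp
  next
    case 4
    then have "16 \<le> (c 1)\<^sup>2" using power_mono[of 4 "\<bar>c 1\<bar>" 2] by simp
    then have "16 \<le> (real_of_int (c 1))\<^sup>2" by (simp flip: of_int_power)
    \<comment> \<open>By \<open>quad\<close> the coefficient of (c 1)^2 exceeds 1/8, and 16/8 =
      2.\<close>
    then have "(2 - (5 * \<gamma>\<^sup>2 + 2 * \<delta>\<^sup>2) / 2) * 16 \<le> (2 - (5 * \<gamma>\<^sup>2 + 2 * \<delta>\<^sup>2) / 2) * (real_of_int (c 1))\<^sup>2"
      using quad by (intro mult_left_mono) auto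
    with quad have "2 < (2 - (5 * \<gamma>\<^sup>2 + 2 * \<delta>\<^sup>2) / 2) * (real_of_int (c 1))\<^sup>2" by argo
    then have "0 + 2 < form8 0 \<gamma> \<delta> (\<lambda>k. of_int (c k))"
      unfolding form8_diagonal by (intro add_le_less_mono mult_nonneg_nonneg add_nonneg_nonneg) auto
    then show ?thesis by simp
  qed
qed

section \<open>The convex decomposition\<close>

text \<open>Matching the neighbour term and total weight 1 forces r = 2 s^2; matching C then forces
  1 - \<gamma> = (1 - C) / r = 1 / (2 (1 + C)). Only \<delta> stays free, and it determines q and
  p.\<close>

lemma form8_decomposition:
  assumes Cs: "C\<^sup>2 + s\<^sup>2 = 1" and s: "0 < s" "s \<le> C"
  obtains p q r \<gamma> \<delta> where "0 \<le> p" "0 \<le> q" "0 < r" "p + q + r = 1"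
    "\<And>c. form8 (C\<^sup>2 - s\<^sup>2) C s c = p * form8 1 1 0 c + q * form8 1 1 (1/2) c + r * form8 0 \<gamma> \<delta> c"
    "1/2 \<le> \<gamma>" "\<gamma> < 1" "1/2 \<le> \<delta>" "\<delta> < 1" "10 * \<gamma> + 4 * \<delta> < 10" "5 * \<gamma>\<^sup>2 + 2 * \<delta>\<^sup>2 < 15/4"
proof -
  define h where "h = sqrt 2"
  have h2: "h\<^sup>2 = 2" and h0: "0 < h" by (simp_all add: h_def)
  have h: "141/100 < h" "h < 71/50"
    using power2_less_imp_less[of "141/100" h] power2_less_imp_less[of h "71/50"] h0
    by (simp_all add: h2 power_divide)
  have "s\<^sup>2 \<le> C\<^sup>2" using s by (intro power_mono) auto
  then have "(h * s)\<^sup>2 \<le> 1" "1\<^sup>2 \<le> (h * C)\<^sup>2" using Cs by (auto simp: power_mult_distrib h2)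
  then have hs: "h * s \<le> 1" and hC: "1 \<le> h * C"
    using s h0 power2_le_imp_le[of "h * s" 1] power2_le_imp_le[of 1 "h * C"] by simp_all
  have C1: "C < 1" using Cs s by (smt (verit) one_le_power zero_less_power)
  have C7: "7/10 < C"
  proof (rule ccontr)
    assume "\<not> 7/10 < C"
    then have "h * C \<le> 71/50 * (7/10)" using s h by (intro mult_mono) auto
    with hC show False by simp
  qed
  define w where "w = 1 / (2 * (1 + C))"
  have w: "1/4 < w" "w < 3/10" using C1 C7 by (simp_all add: w_def field_simps)
  define \<gamma> \<delta> where "\<gamma> = 1 - w" and "\<delta> = (1 + h) * w"
  \<comment> \<open>The factor \<open>1 + h\<close> makes both weights \<open>p\<close> and \<open>q\<close> vanish at \<open>\<alpha> = sqrt 2\<close>, i.e. \<open>C = s\<close>.\<close>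
  define q where "q = 2 * (s - (1 + h) * (1 - C))"
  define p where "p = C\<^sup>2 - s\<^sup>2 - q"
  define r where "r = 2 * s\<^sup>2"
  have r: "r = 2 * (1 - C) * (1 + C)" using Cs unfolding r_def by algebra
  have "2 * (1 + C) * w = 1" using C7 by (simp add: w_def)
  then have rw: "r * w = 1 - C" unfolding r by algebra
  have sum: "p + q + r = 1" using Cs unfolding p_def r_def by algebra
  have q0: "0 \<le> q"
  proof -
    \<comment> \<open>The factor 1 + C turns 1 - C into s^2, after which q >= 0 reduces to s + h s
      <= C + 1.\<close>
    have "(1 + h) * (1 - C) * (1 + C) = (1 + h) * (s * s)" using Cs by algebra
    also have "\<dots> = (s + h * s) * s" by algebra
    also have "\<dots> \<le> s * (1 + C)"
      using hs s by (smt (verit) mult.commute mult_left_mono hC h0 mult_le_cancel_left_pos)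
    finally show ?thesis using C7 by (simp add: q_def)
  qed
  have p0: "0 \<le> p"
  proof -
    \<comment> \<open>On the circle C^2 + s^2 = 1, p is a positive combination of squares centred at
      C = s = h / 2, the point where it vanishes.\<close>
    have "p = (1 + h / 2) * 2 * (C - h / 2)\<^sup>2 + h * (s - h / 2)\<^sup>2"
      using Cs h2 unfolding p_def q_def by algebra
    then show ?thesis using h0 by simp
  qed
  \<comment> \<open>Between 1/4 and 3/10 the square of w lies below its chord, which makes the
    estimate for \<open>quad\<close> linear in w.\<close>
  have "(w - 1/4) * (w - 3/10) \<le> 0" using w by (intro mult_nonneg_nonpos) auto
  moreover have "(w - 1/4) * (w - 3/10) = w\<^sup>2 - 11/20 * w + 3/40"
    by (simp add: power2_eq_square field_simps)
  ultimately have w2: "w\<^sup>2 \<le> 11/20 * w - 3/40" by linarith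
  \<comment> \<open>Here (1 + h)^2 = 3 + 2 h < 6, and 17 below is 5 + 2 * 6.\<close>
  have "(1 + h)\<^sup>2 * w\<^sup>2 \<le> 6 * w\<^sup>2"
    using h h2 by (intro mult_right_mono) (auto simp: power2_eq_square algebra_simps)
  then have "5 * \<gamma>\<^sup>2 + 2 * \<delta>\<^sup>2 \<le> 5 - 10 * w + 17 * w\<^sup>2"
    unfolding \<gamma>_def \<delta>_def by (simp add: power_mult_distrib power2_diff mult.commute)
  then have quad: "5 * \<gamma>\<^sup>2 + 2 * \<delta>\<^sup>2 < 15/4" using w2 w by linarith
  have hw: "h * w \<le> 71/50 * w" "141/100 * w \<le> h * w" using h w by (intro mult_right_mono; simp)+
  show thesis
  proof
    show "0 \<le> p" "0 \<le> q" "0 < r" using p0 q0 s by (simp_all add: r_def)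
    show "form8 (C\<^sup>2 - s\<^sup>2) C s c = p * form8 1 1 0 c + q * form8 1 1 (1/2) c + r * form8 0 \<gamma> \<delta> c" for c
    proof -
      have "p + q = C\<^sup>2 - s\<^sup>2" by (simp add: p_def)
      moreover have "p + q + r * \<gamma> = C" using sum rw unfolding \<gamma>_def by algebra
      moreover have "q / 2 + r * \<delta> = s" using rw unfolding \<delta>_def q_def by algebra
      ultimately show ?thesis using form8_combination[OF sum, of \<gamma> \<delta> c] by simp
    qed
    have \<delta>: "\<delta> = w + h * w" by (simp add: \<delta>_def distrib_right)
    show "1/2 \<le> \<gamma>" "\<gamma> < 1" "1/2 \<le> \<delta>" "\<delta> < 1"
      using w hw unfolding \<gamma>_def \<delta> by linarith+
    have "10 * \<gamma> + 4 * \<delta> = 10 - 6 * w + 4 * (h * w)" unfolding \<gamma>_def \<delta> by simp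
    then show "10 * \<gamma> + 4 * \<delta> < 10" using w hw by linarith
  qed (fact sum quad)+
qed

section \<open>The minimal vectors of the lattice\<close>

lemma sum_squares_eq_one:
  fixes c :: "'a \<Rightarrow> int"
  assumes "finite A" "(\<Sum>k\<in>A. (c k)\<^sup>2) = 1"
  obtains k where "k \<in> A" "\<bar>c k\<bar> = 1" "\<And>j. j \<in> A - {k} \<Longrightarrow> c j = 0"
proof -
  from assms(2) obtain k where k: "k \<in> A" "(c k)\<^sup>2 \<noteq> 0" by (metis sum.neutral zero_neq_one)
  then have "1 \<le> (c k)\<^sup>2" by (metis int_one_le_iff_zero_less zero_le_power2 order_le_less)
  moreover have "(\<Sum>j\<in>A. (c j)\<^sup>2) = (c k)\<^sup>2 + (\<Sum>j\<in>A - {k}. (c j)\<^sup>2)" using assms(1) k(1) by (rule sum.remove)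
  moreover have "0 \<le> (\<Sum>j\<in>A - {k}. (c j)\<^sup>2)" by (simp add: sum_nonneg)
  ultimately have one: "(c k)\<^sup>2 = 1" and zero: "(\<Sum>j\<in>A - {k}. (c j)\<^sup>2) = 0" using assms(2) by linarith+
  show thesis
  proof (rule that[OF k(1)])
    show "\<bar>c k\<bar> = 1" using one by (auto simp: power2_eq_1_iff)
    show "c j = 0" if "j \<in> A - {k}" for j
      using zero that assms(1) by (simp add: sum_nonneg_eq_0_iff)
  qed
qed

locale E8_family =
  fixes \<alpha> :: real
  assumes gt1: "1 < \<alpha>" and le: "\<alpha> \<le> sqrt 2"
begin

lemma \<alpha>_sq_le: "\<alpha>\<^sup>2 \<le> 2"
  using power_mono[OF le, of 2] gt1 by simp

text \<open>From \<alpha> > 1 follows \<open>alpha_bar \<alpha>\<close> < \<alpha>, hence s > 0 and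
  a positive weight r; nonnegativity of \<open>alpha_bar \<alpha>\<close> is s <= C.\<close>

lemma norm_decomposition:
  obtains p q r \<gamma> \<delta> where "0 \<le> p" "0 \<le> q" "0 < r" "p + q + r = 1"
    "\<And>c. (norm (\<Sum>k\<in>{1..8}. c k *\<^sub>R E8b \<alpha> k))\<^sup>2 =
       p * form8 1 1 0 c + q * form8 1 1 (1/2) c + r * form8 0 \<gamma> \<delta> c"
    "1/2 \<le> \<gamma>" "\<gamma> < 1" "1/2 \<le> \<delta>" "\<delta> < 1" "10 * \<gamma> + 4 * \<delta> < 10" "5 * \<gamma>\<^sup>2 + 2 * \<delta>\<^sup>2 < 15/4"
proof -
  define b where "b = alpha_bar \<alpha>"
  have b: "b\<^sup>2 = 2 - \<alpha>\<^sup>2" "0 \<le> b" using \<alpha>_sq_le by (simp_all add: b_def alpha_bar_def)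
  have "1 < \<alpha>\<^sup>2" using gt1 by (simp add: power2_eq_square less_1_mult)
  then have "b\<^sup>2 < \<alpha>\<^sup>2" using b by simp
  then have "b < \<alpha>" by (rule power2_less_imp_less) (use gt1 in simp)
  moreover have "((\<alpha> + b) / 2)\<^sup>2 + ((\<alpha> - b) / 2)\<^sup>2 = (\<alpha>\<^sup>2 + b\<^sup>2) / 2"
    by (simp add: power2_eq_square field_simps)
  ultimately have Cs: "((\<alpha> + b) / 2)\<^sup>2 + ((\<alpha> - b) / 2)\<^sup>2 = 1" "0 < (\<alpha> - b) / 2" "(\<alpha> - b) / 2 \<le> (\<alpha> + b) / 2"
    using b by simp_all
  from that show thesis
    by (rule form8_decomposition[OF Cs, folded norm_lattice_vector[OF \<alpha>_sq_le, folded b_def]])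
qed

text \<open>All three forms are positive definite on real coefficients, so linear independence
  follows from the norm formula without a determinant.\<close>

lemma E8b_scalars_zero:
  assumes "(\<Sum>k\<in>{1..8}. c k *\<^sub>R E8b \<alpha> k) = 0" "k \<in> {1..8}"
  shows "c k = 0"
proof (rule ccontr)
  assume "c k \<noteq> 0"
  then have nz: "\<exists>k\<in>{1..8}. c k \<noteq> 0" using assms(2) by blast
  obtain p q r \<gamma> \<delta> where *: "0 \<le> p" "0 \<le> q" "0 < r" "5 * \<gamma>\<^sup>2 + 2 * \<delta>\<^sup>2 < 15/4"
    "(norm (\<Sum>k\<in>{1..8}. c k *\<^sub>R E8b \<alpha> k))\<^sup>2 =
       p * form8 1 1 0 c + q * form8 1 1 (1/2) c + r * form8 0 \<gamma> \<delta> c"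
    by (rule norm_decomposition) blast
  have "0 < p * form8 1 1 0 c + q * form8 1 1 (1/2) c + r * form8 0 \<gamma> \<delta> c"
    using * form8_root_lattice_pos[OF nz] form8_tilted_pos[OF nz] form8_diagonal_pos[OF nz]
    by (intro add_nonneg_pos add_nonneg_nonneg) auto
  with * assms(1) show False by simp
qed

text \<open>The first two forms contribute only their bound 2. Since r > 0, squared norm 2 forces
  the diagonal form to equal 2 as well, and its equality case identifies the coefficients.\<close>

lemma lattice_vector_norm_ge:
  fixes c :: "nat \<Rightarrow> int"
  assumes nz: "\<exists>k\<in>{1..8}. c k \<noteq> 0"
  defines "x \<equiv> \<Sum>k\<in>{1..8}. of_int (c k) *\<^sub>R E8b \<alpha> k"
  shows "2 < (norm x)\<^sup>2 \<or> (norm x)\<^sup>2 = 2 \<and> (\<Sum>k\<in>{1..8}. (c k)\<^sup>2) = 1"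
proof -
  obtain p q r \<gamma> \<delta> where *: "0 \<le> p" "0 \<le> q" "0 < r" "p + q + r = 1"
    and \<gamma>\<delta>: "1/2 \<le> \<gamma>" "\<gamma> < 1" "1/2 \<le> \<delta>" "\<delta> < 1" "10 * \<gamma> + 4 * \<delta> < 10" "5 * \<gamma>\<^sup>2 + 2 * \<delta>\<^sup>2 < 15/4"
    and eq: "\<And>c. (norm (\<Sum>k\<in>{1..8}. c k *\<^sub>R E8b \<alpha> k))\<^sup>2 =
       p * form8 1 1 0 c + q * form8 1 1 (1/2) c + r * form8 0 \<gamma> \<delta> c"
    by (rule norm_decomposition) blast
  have "p * 2 \<le> p * form8 1 1 0 (\<lambda>k. of_int (c k))" "q * 2 \<le> q * form8 1 1 (1/2) (\<lambda>k. of_int (c k))"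
    using * form8_root_lattice_ge[OF nz] form8_tilted_ge[OF nz] by (simp_all add: mult_left_mono)
  then have ge: "2 + r * (form8 0 \<gamma> \<delta> (\<lambda>k. of_int (c k)) - 2) \<le> (norm x)\<^sup>2"
    using *(4) unfolding x_def eq by (simp add: algebra_simps)
  from form8_diagonal_ge[OF nz \<gamma>\<delta>] show ?thesis
  proof (elim disjE conjE)
    assume "2 < form8 0 \<gamma> \<delta> (\<lambda>k. of_int (c k))"
    then have "0 < r * (form8 0 \<gamma> \<delta> (\<lambda>k. of_int (c k)) - 2)" using * by simp
    with ge show ?thesis by linarith
  next
    assume "form8 0 \<gamma> \<delta> (\<lambda>k. of_int (c k)) = 2" "(\<Sum>k\<in>{1..8}. (c k)\<^sup>2) = 1"
    with ge show ?thesis by auto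
  qed
qed

lemma norm_E8b:
  assumes "k \<in> {1..8}"
  shows "norm (E8b \<alpha> k) = sqrt 2"
proof -
  have sum: "(\<Sum>j\<in>{1..8}. (if j = k then 1 else 0) *\<^sub>R E8b \<alpha> j) = E8b \<alpha> k"
    using assms by (simp add: if_distrib[of "\<lambda>x. x *\<^sub>R _"] cong: if_cong)
  \<comment> \<open>With a single nonzero coefficient every product vanishes, whatever the
    parameters.\<close>
  have "form8 \<tau> \<gamma> \<delta> (\<lambda>j. if j = k then 1 else 0) = 2" for \<tau> \<gamma> \<delta>
    using assms unfolding form8_expand Icc_1 by (elim insertE) simp_all
  with norm_lattice_vector[OF \<alpha>_sq_le, of "\<lambda>j. if j = k then 1 else 0"]
  have "(norm (E8b \<alpha> k))\<^sup>2 = 2" unfolding sum by simp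
  then show ?thesis by (metis norm_ge_zero real_sqrt_unique)
qed

lemma E8b_in_lattice:
  assumes "k \<in> {1..8}"
  shows "E8b \<alpha> k \<in> E8_alpha \<alpha>"
proof -
  have "E8b \<alpha> k = (\<Sum>j\<in>{1..8}. of_int (if j = k then 1 else 0) *\<^sub>R E8b \<alpha> j)"
    using assms by (simp add: if_distrib[of "\<lambda>x. x *\<^sub>R _"] if_distrib[of of_int] cong: if_cong)
  then show ?thesis unfolding E8_alpha_def by (intro CollectI exI[of _ "\<lambda>j. if j = k then 1 else 0"]) simp
qed

lemma uminus_in_lattice:
  assumes "x \<in> E8_alpha \<alpha>" shows "- x \<in> E8_alpha \<alpha>"
proof -
  from assms obtain c :: "nat \<Rightarrow> int" where "x = (\<Sum>k\<in>{1..8}. of_int (c k) *\<^sub>R E8b \<alpha> k)"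
    unfolding E8_alpha_def by blast
  then have "- x = (\<Sum>k\<in>{1..8}. of_int (- c k) *\<^sub>R E8b \<alpha> k)" by (simp add: sum_negf)
  then show ?thesis unfolding E8_alpha_def by (intro CollectI exI[of _ "\<lambda>k. - c k"]) simp
qed

lemma lattice_norm_cases:
  assumes "x \<in> E8_alpha \<alpha>" "x \<noteq> 0"
  shows "sqrt 2 < norm x \<or> norm x = sqrt 2 \<and> (\<exists>k\<in>{1..8}. x = E8b \<alpha> k \<or> x = - E8b \<alpha> k)"
proof -
  from assms(1) obtain c :: "nat \<Rightarrow> int" where x: "x = (\<Sum>k\<in>{1..8}. of_int (c k) *\<^sub>R E8b \<alpha> k)"
    unfolding E8_alpha_def by blast
  have "\<exists>k\<in>{1..8}. c k \<noteq> 0" using assms(2) unfolding x by (metis (mono_tags, lifting) of_int_0 scaleR_zero_left sum.neutral)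
  from lattice_vector_norm_ge[OF this, folded x] show ?thesis
  proof (elim disjE conjE)
    assume "2 < (norm x)\<^sup>2"
    then show ?thesis by (simp add: real_less_lsqrt)
  next
    assume n: "(norm x)\<^sup>2 = 2" and "(\<Sum>k\<in>{1..8}. (c k)\<^sup>2) = 1"
    then obtain k where k: "k \<in> {1..8}" "\<bar>c k\<bar> = 1" "\<And>j. j \<in> {1..8} - {k} \<Longrightarrow> c j = 0"
      using sum_squares_eq_one[of "{1..8}" c] by auto
    have "x = of_int (c k) *\<^sub>R E8b \<alpha> k"
      unfolding x using k by (subst sum.remove[of _ k]) auto
    moreover have "c k = 1 \<or> c k = - 1" using k(2) by arith
    moreover have "norm x = sqrt 2" using n by (metis norm_ge_zero real_sqrt_unique)
    ultimately show ?thesis using k(1) by auto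
  qed
qed

lemma lambda1_eq: "lambda1 (E8_alpha \<alpha>) = sqrt 2"
  unfolding lambda1_def
proof (rule cInf_eq_minimum)
  have "E8b \<alpha> 1 \<noteq> 0" using norm_E8b[of 1] by auto
  then show "sqrt 2 \<in> {norm x |x. x \<in> E8_alpha \<alpha> \<and> x \<noteq> 0}"
    using norm_E8b[of 1] E8b_in_lattice[of 1] by force
next
  fix r assume "r \<in> {norm x |x. x \<in> E8_alpha \<alpha> \<and> x \<noteq> 0}"
  then obtain x where "r = norm x" "x \<in> E8_alpha \<alpha>" "x \<noteq> 0" by blast
  then show "sqrt 2 \<le> r" using lattice_norm_cases[of x] by linarith
qed

lemma min_vectors_eq:
  "min_vectors (E8_alpha \<alpha>) = E8b \<alpha> ` {1..8} \<union> (\<lambda>k. - E8b \<alpha> k) ` {1..8}"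
proof (intro equalityI subsetI)
  fix x assume "x \<in> min_vectors (E8_alpha \<alpha>)"
  then have "x \<in> E8_alpha \<alpha>" "norm x = sqrt 2" by (simp_all add: min_vectors_def lambda1_eq)
  moreover from this have "x \<noteq> 0" by auto
  ultimately show "x \<in> E8b \<alpha> ` {1..8} \<union> (\<lambda>k. - E8b \<alpha> k) ` {1..8}"
    using lattice_norm_cases[of x] by (metis UnI1 UnI2 imageI less_irrefl)
next
  fix x assume "x \<in> E8b \<alpha> ` {1..8} \<union> (\<lambda>k. - E8b \<alpha> k) ` {1..8}"
  then obtain k where k: "k \<in> {1..8}" "x = E8b \<alpha> k \<or> x = - E8b \<alpha> k" by blast
  then have "norm x = sqrt 2" "x \<in> E8_alpha \<alpha>"
    using norm_E8b[OF k(1)] E8b_in_lattice[OF k(1)] uminus_in_lattice by (elim disjE; simp)+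
  then show "x \<in> min_vectors (E8_alpha \<alpha>)" by (simp add: min_vectors_def lambda1_eq)
qed

section \<open>Independence, spanning and counting\<close>

text \<open>Used with b = -1 for injectivity and with b = 1 to separate the generators from their
  negatives. The case i = j is set apart because the two coefficients then merge.\<close>

lemma E8b_combination_nonzero:
  assumes "i \<in> {1..8}" "j \<in> {1..8}" "a *\<^sub>R E8b \<alpha> i + b *\<^sub>R E8b \<alpha> j = 0"
  shows "i = j \<or> a = 0"
proof (rule ccontr)
  assume ne: "\<not> (i = j \<or> a = 0)"
  define c where "c k = (if k = i then a else 0) + (if k = j then b else 0)" for k
  have "(\<Sum>k\<in>{1..8}. c k *\<^sub>R E8b \<alpha> k) = a *\<^sub>R E8b \<alpha> i + b *\<^sub>R E8b \<alpha> j"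
    using assms(1,2) by (simp add: c_def scaleR_add_left sum.distrib if_distrib[of "\<lambda>x. x *\<^sub>R _"] cong: if_cong)
  with E8b_scalars_zero[of c i] assms ne show False by (simp add: c_def)
qed

lemma inj_on_E8b: "inj_on (E8b \<alpha>) {1..8}"
  using E8b_combination_nonzero[of _ _ 1 "-1"] by (auto intro!: inj_onI)

lemma span_E8b: "span (E8b \<alpha> ` {1..8}) = UNIV"
proof -
  have "independent (E8b \<alpha> ` {1..8})"
  proof (rule independent_if_scalars_zero)
    fix f x assume sum: "(\<Sum>x\<in>E8b \<alpha> ` {1..8}. f x *\<^sub>R x) = 0" and "x \<in> E8b \<alpha> ` {1..8}"
    then obtain k where k: "k \<in> {1..8}" "x = E8b \<alpha> k" by blast
    have "(\<Sum>k\<in>{1..8}. f (E8b \<alpha> k) *\<^sub>R E8b \<alpha> k) = 0"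
      using sum unfolding sum.reindex[OF inj_on_E8b] by simp
    from E8b_scalars_zero[OF this k(1)] show "f x = 0" unfolding k(2) .
  qed simp
  moreover have "card (E8b \<alpha> ` {1..8}) = DIM(real^8)" using card_image[OF inj_on_E8b] by simp
  ultimately show ?thesis
    by (metis card_ge_dim_independent dim_UNIV order_refl subset_UNIV top.extremum_uniqueI)
qed

lemma generic_well_rounded_E8_alpha: "generic_well_rounded (E8_alpha \<alpha>)"
proof -
  have "span (min_vectors (E8_alpha \<alpha>)) = UNIV"
    using span_mono[of "E8b \<alpha> ` {1..8}" "min_vectors (E8_alpha \<alpha>)"] span_E8b by (auto simp: min_vectors_eq)
  moreover have "E8b \<alpha> i \<noteq> - E8b \<alpha> j" if "i \<in> {1..8}" "j \<in> {1..8}" for i j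
  proof
    assume eq: "E8b \<alpha> i = - E8b \<alpha> j"
    then have "i = j" using E8b_combination_nonzero[OF that, of 1 1] by simp
    \<comment> \<open>With i = j the equation says that twice the vector is zero.\<close>
    with eq have "E8b \<alpha> i = 0" by (metis eq_neg_iff_add_eq_0 scaleR_2 scaleR_eq_0_iff zero_neq_numeral)
    then show False using norm_E8b[OF that(1)] by simp
  qed
  then have "E8b \<alpha> ` {1..8} \<inter> (\<lambda>k. - E8b \<alpha> k) ` {1..8} = {}" by blast
  then have "card (min_vectors (E8_alpha \<alpha>)) = card (E8b \<alpha> ` {1..8}) + card ((\<lambda>k. - E8b \<alpha> k) ` {1..8})"
    unfolding min_vectors_eq by (intro card_Un_disjoint) auto
  moreover have "inj_on (\<lambda>k. - E8b \<alpha> k) {1..8}" using inj_on_E8b by (auto simp: inj_on_def)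
  ultimately show ?thesis
    using inj_on_E8b by (simp add: generic_well_rounded_def card_image)
qed

end

theorem mainTheorem19:
  fixes \<alpha> :: real
  assumes "1 < \<alpha>" and "\<alpha> \<le> sqrt 2"
  shows "min_vectors (E8_alpha \<alpha>) = {E8b \<alpha> k | k. k \<in> {1..8}} \<union> {- E8b \<alpha> k | k. k \<in> {1..8}}
         \<and> (lambda1 (E8_alpha \<alpha>))\<^sup>2 = 2
         \<and> generic_well_rounded (E8_alpha \<alpha>)"
proof -
  interpret E8_family \<alpha> using assms by unfold_locales
  show ?thesis
    using min_vectors_eq lambda1_eq generic_well_rounded_E8_alpha by (auto simp: image_def)
qed

end
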